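(* Let $X$ be a Souslin line (with its order topology). Then $X$ is functionally countable if and only if $X$ is exponentially separable.
   Context: A Souslin line is a linearly ordered set that, with the order topology, is ccc (every family of pairwise disjoint nonempty open sets is countable) but not separable. A space $X$ is functionally countable if $f[X]$ is countable for every continuous $f\colon X\to\mathbb{R}$. Given a family $\mathcal{F}$ of subsets of $X$, a set $A\subset X$ is strongly dense in $\mathcal{F}$ if $A\cap\bigcap\mathcal{G}\neq\emptyset$ whenever $\mathcal{G}\subset\mathcal{F}$ and $\bigcap\mathcal{G}\neq\emptyset$. $X$ is exponentially separable if for every countable family $\mathcal{F}$ of closed subsets of $X$ there is a countable $A\subset X$ that is strongly dense in $\mathcal{F}$. *)

theory Defs
  imports "HOL-Analysis.Analysis"
begin

definition ccc_space :: "'a topology \<Rightarrow> bool" where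
  "ccc_space X \<longleftrightarrow>
     (\<forall>\<U>. (\<forall>U\<in>\<U>. openin X U \<and> U \<noteq> {}) \<and> pairwise disjnt \<U> \<longrightarrow> countable \<U>)"

(* The instances of linorder_topology are exactly the linear orders carrying their order
   topology, so here and below the linearly ordered set is the universe of the type. *)
definition souslin_line :: "'a::linorder_topology itself \<Rightarrow> bool" where
  "souslin_line _ \<longleftrightarrow>
     ccc_space (euclidean :: 'a topology) \<and> \<not> separable_space (euclidean :: 'a topology)"

definition functionally_countable :: "'a topology \<Rightarrow> bool" where
  "functionally_countable X \<longleftrightarrow>
     (\<forall>f :: 'a \<Rightarrow> real. continuous_map X euclideanreal f \<longrightarrow> countable (f ` topspace X))"

(* Intersecting with topspace X only fixes the intersection of the empty subfamily to be
   the whole space. *)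
definition strongly_dense_in :: "'a topology \<Rightarrow> 'a set \<Rightarrow> 'a set set \<Rightarrow> bool" where
  "strongly_dense_in X A \<F> \<longleftrightarrow>
     (\<forall>\<G>. \<G> \<subseteq> \<F> \<and> topspace X \<inter> \<Inter>\<G> \<noteq> {} \<longrightarrow> A \<inter> (topspace X \<inter> \<Inter>\<G>) \<noteq> {})"

definition exponentially_separable :: "'a topology \<Rightarrow> bool" where
  "exponentially_separable X \<longleftrightarrow>
     (\<forall>\<F>. countable \<F> \<and> (\<forall>C\<in>\<F>. closedin X C) \<longrightarrow>
        (\<exists>A. countable A \<and> A \<subseteq> topspace X \<and> strongly_dense_in X A \<F>))"

end

theory Submission
  imports Defs
begin

text \<open>Exponential separability always implies functional countability: a set that is strongly
dense in the preimages of the rays with rational end point meets every fibre of the map.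
For the converse, functional countability makes the line zero-dimensional in a strong way:
for \<open>c < a\<close> a continuous monotone map from \<open>c\<close> to \<open>a\<close> omits a value, and cutting there gives a
clopen set between \<open>{a..}\<close> and \<open>{c<..}\<close>. By the ccc, an open set has countably many
convex components and each has countable cofinality and coinitiality, so every open set is a
countable union of clopen sets. Hence a countable family of closed sets is determined by
countably many clopen sets, whose characteristic functions combine into one real-valued
continuous map; choosing one point in each of its countably many fibres yields a strongly
dense set.\<close>

section \<open>Exponential separability implies functional countability\<close>

lemma exponentially_separable_imp_functionally_countable:
  assumes "exponentially_separable X"
  shows "functionally_countable X"
  unfolding functionally_countable_def
proof (intro allI impI)
  fix f :: "'a \<Rightarrow> real"
  assume f: "continuous_map X euclideanreal f"
  define P where "P S = {x \<in> topspace X. f x \<in> S}" for S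
  define \<F> where "\<F> = (\<lambda>q. P {q..}) ` \<rat> \<union> (\<lambda>q. P {..q}) ` \<rat>"
  have "countable \<F>"
    by (simp add: \<F>_def countable_rat)
  moreover have "closedin X C" if C: "C \<in> \<F>" for C
  proof -
    obtain q where "C = P {q..} \<or> C = P {..q}"
      using C unfolding \<F>_def by blast
    then obtain S where "closed S" "C = P S"
      using closed_atLeast[of q] closed_atMost[of q] by blast
    then show ?thesis
      using closedin_continuous_map_preimage[OF f, of S] by (simp add: P_def)
  qed
  ultimately obtain A where A: "countable A" "A \<subseteq> topspace X" "strongly_dense_in X A \<F>"
    using assms unfolding exponentially_separable_def by blast
  have "f x \<in> f ` A" if x: "x \<in> topspace X" for x
  proof -
    \<comment> \<open>The intersection of \<open>\<G>\<close> contains \<open>x\<close>, and it is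
      exactly the fibre of \<open>f\<close> through \<open>x\<close>: the rational rays containing
      \<open>f x\<close> leave no other value, since a rational lies strictly between any two
      distinct reals.\<close>
    define \<G> where "\<G> = {C \<in> \<F>. x \<in> C}"
    have "topspace X \<inter> \<Inter>\<G> \<noteq> {}"
      using x by (auto simp: \<G>_def)
    moreover have "\<G> \<subseteq> \<F>"
      by (auto simp: \<G>_def)
    ultimately have "A \<inter> (topspace X \<inter> \<Inter>\<G>) \<noteq> {}"
      using A(3) unfolding strongly_dense_in_def by simp
    then obtain y where y: "y \<in> A" "y \<in> \<Inter>\<G>"
      by blast
    have "f y \<ge> q" if "q \<in> \<rat>" "q \<le> f x" for q
    proof -
      have "P {q..} \<in> \<G>"
        using that x by (auto simp: \<G>_def \<F>_def P_def)
      then show ?thesis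
        using y by (auto simp: P_def)
    qed
    moreover have "f y \<le> q" if "q \<in> \<rat>" "f x \<le> q" for q
    proof -
      have "P {..q} \<in> \<G>"
        using that x by (auto simp: \<G>_def \<F>_def P_def)
      then show ?thesis
        using y by (auto simp: P_def)
    qed
    ultimately have "f y = f x"
      by (metis Rats_dense_in_real less_le_not_le linorder_neqE_linordered_idom)
    then show ?thesis
      using y(1) by (metis imageI)
  qed
  then show "countable (f ` topspace X)"
    using A(1) by (meson countable_image countable_subset image_subsetI)
qed

section \<open>Clopen cuts\<close>

lemma dyadics_dense:
  fixes s t :: real
  assumes "0 \<le> s" "s < t"
  obtains r where "r \<in> dyadics" "s < r" "r < t"
proof -
  have "0 < (t - s) / 2" "1 < (2::real)" "0 < (s + t) / 2"
    using assms by auto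
  then obtain n q r where q: "of_nat q / 2^n < (s + t) / 2" "(s + t) / 2 < of_nat r / 2^n"
      "\<bar>of_nat q / 2^n - of_nat r / 2^n\<bar> < (t - s) / 2"
    by (rule padic_rational_approximation_straddle_pos)
  show thesis
  proof
    show "of_nat q / 2^n \<in> (dyadics :: real set)"
      by (auto simp: dyadics_def)
    show "s < of_nat q / 2^n" "of_nat q / 2^n < t"
      using q assms(2) by argo+
  qed
qed

text \<open>Urysohn's construction with points instead of open sets: density allows the dyadic
  fractions of \<open>{0..1}\<close> to be embedded increasingly between \<open>c\<close> and
  \<open>a\<close>, and \<open>f x\<close> is the supremum of the dyadics whose image lies below
  \<open>x\<close>. No completeness of the order is required, because the strict level sets of
  \<open>f\<close> are unions of open rays.\<close>

lemma continuous_map_across_dense_interval: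
  fixes c a :: "'a::linorder_topology"
  assumes ca: "c < a"
    and dense: "\<And>x y. \<lbrakk>c \<le> x; x < y; y \<le> a\<rbrakk> \<Longrightarrow> \<exists>z. x < z \<and> z < y"
  obtains f :: "'a \<Rightarrow> real"
  where "continuous_on UNIV f" "\<And>x. x \<le> c \<Longrightarrow> f x = 0" "\<And>x. a \<le> x \<Longrightarrow> f x = 1"
proof -
  have "\<exists>G :: real \<Rightarrow> 'a. G 0 = c \<and> G 1 = a \<and>
          (\<forall>x \<in> dyadics \<inter> {0..1}. \<forall>y \<in> dyadics \<inter> {0..1}. x < y \<longrightarrow>
             c \<le> G x \<and> G x < G y \<and> G y \<le> a)"
  proof (rule recursion_on_dyadic_fractions)
    show "\<exists>z. (c \<le> x \<and> x < z \<and> z \<le> a) \<and> c \<le> z \<and> z < y \<and> y \<le> a"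
      if "c \<le> x \<and> x < y \<and> y \<le> a" for x y
      using dense[of x y] that by force
  qed (use ca in auto)
  then obtain G :: "real \<Rightarrow> 'a" where G0: "G 0 = c" and G1: "G 1 = a"
    and G: "\<And>x y. \<lbrakk>x \<in> dyadics \<inter> {0..1}; y \<in> dyadics \<inter> {0..1}; x < y\<rbrakk> \<Longrightarrow>
              c \<le> G x \<and> G x < G y \<and> G y \<le> a"
    by metis
  define D where "D = (dyadics \<inter> {0..1} :: real set)"
  have D01: "0 \<in> D" "1 \<in> D"
    by (force simp: D_def dyadics_def)+
  have D_dense: "\<exists>r\<in>D. s < r \<and> r < t" if "0 \<le> s" "s < t" "t \<le> 1" for s t
  proof -
    obtain r where "r \<in> dyadics" "s < r" "r < t"
      using dyadics_dense[OF \<open>0 \<le> s\<close> \<open>s < t\<close>] .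
    then show ?thesis
      using that by (intro bexI[of _ r]) (auto simp: D_def)
  qed
  have Gless: "G x < G y" if "x \<in> D" "y \<in> D" "x < y" for x y
    using G that by (auto simp: D_def)
  have Gge: "c \<le> G r" if "r \<in> D" for r
    using Gless[of 0 r] that D01 G0 by (cases "r = 0") (auto simp: D_def)
  \<comment> \<open>The added \<open>0\<close> keeps the set nonempty, so \<open>Sup\<close> is
    meaningful, and gives the value \<open>0\<close> at points \<open>x \<le> c\<close>.\<close>
  define S where "S x = insert 0 {r \<in> D. G r < x}" for x
  define f where "f x = Sup (S x)" for x
  have bdd: "bdd_above (S x)" and ne: "S x \<noteq> {}" for x
    by (auto simp: S_def D_def bdd_above_def intro!: exI[of _ 1])
  have f_upper: "r \<le> f x" if "r \<in> D" "G r < x" for r x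
    unfolding f_def using that by (intro cSup_upper bdd) (auto simp: S_def)
  have f0: "0 \<le> f x" for x
    unfolding f_def by (intro cSup_upper bdd) (auto simp: S_def)
  have f_le: "f x \<le> u" if "0 \<le> u" "\<And>r. \<lbrakk>r \<in> D; G r < x\<rbrakk> \<Longrightarrow> r \<le> u" for x u
    unfolding f_def using that by (intro cSup_least ne) (auto simp: S_def)
  have f1: "f x \<le> 1" for x
    by (rule f_le) (auto simp: D_def)
  have gt: "t < f x \<longleftrightarrow> t < 0 \<or> (\<exists>q\<in>D. t < q \<and> G q < x)" for t x
    unfolding f_def using less_cSup_iff[OF ne bdd, of t x] by (auto simp: S_def)
  have lt: "f x < t \<longleftrightarrow> 1 < t \<or> (\<exists>q\<in>D. q < t \<and> x < G q)" if t: "0 < t" "t \<le> 1" for t x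
  proof
    assume *: "f x < t"
    \<comment> \<open>Two dyadics are taken because \<open>f x < q'\<close> yields only
      \<open>x \<le> G q'\<close>; the larger \<open>q\<close> makes the inequality strict.\<close>
    obtain q' where q': "q' \<in> D" "f x < q'" "q' < t"
      using D_dense[of "f x" t] * f0[of x] t by auto
    obtain q where q: "q \<in> D" "q' < q" "q < t"
      using D_dense[of q' t] q' f0[of x] t by auto
    have "x \<le> G q'"
      using f_upper[of q' x] q' by force
    also have "\<dots> < G q"
      using Gless q q' by auto
    finally show "1 < t \<or> (\<exists>q\<in>D. q < t \<and> x < G q)"
      using q by auto
  next
    assume "1 < t \<or> (\<exists>q\<in>D. q < t \<and> x < G q)"
    then obtain q where q: "q \<in> D" "q < t" "x < G q"
      using t by auto
    have "f x \<le> q"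
    proof (rule f_le)
      show "r \<le> q" if "r \<in> D" "G r < x" for r
        using Gless[of q r] that q by force
    qed (use q in \<open>auto simp: D_def\<close>)
    with q show "f x < t"
      by simp
  qed
  show thesis
  proof
    have "open {x. t < f x}" for t
    proof -
      have "{x. t < f x} = (if t < 0 then UNIV else (\<Union>q\<in>{q\<in>D. t < q}. {G q<..}))"
        by (auto simp: gt)
      then show ?thesis
        by auto
    qed
    moreover have "open {x. f x < t}" for t
    proof -
      consider "t \<le> 0" | "t > 1" | "0 < t" "t \<le> 1"
        by linarith
      then show ?thesis
      proof cases
        case 1
        then have "{x. f x < t} = {}"
          using f0 by (force simp: not_less intro: order_trans)
        then show ?thesis by simp
      next
        case 2
        then have "{x. f x < t} = UNIV"
          using f1 by (force intro: le_less_trans)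
        then show ?thesis by simp
      next
        case 3
        then have "{x. f x < t} = (\<Union>q\<in>{q\<in>D. q < t}. {..<G q})"
          using lt[OF 3] by auto
        then show ?thesis
          by auto
      qed
    qed
    ultimately have "continuous_map euclidean euclideanreal f"
      by (simp add: continuous_map_upper_lower_semicontinuous_lt del: continuous_map_iff_continuous2)
    then show "continuous_on UNIV f"
      by simp
    show "f x = 0" if "x \<le> c" for x
      using gt[of 0 x] f0[of x] Gge that by force
    show "f x = 1" if "a \<le> x" for x
    proof (rule ccontr)
      assume "f x \<noteq> 1"
      then obtain q where q: "q \<in> D" "f x < q" "q < 1"
        using D_dense[of "f x" 1] f1[of x] f0[of x] by force
      then have "G q < x"
        using Gless[of q 1] D01 G1 that by auto
      then show False
        using f_upper q by force
    qed
  qed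
qed

section \<open>Clopen sets obtained from omitted values\<close>

lemma functionally_countable_omits:
  fixes f :: "'a::topological_space \<Rightarrow> real"
  assumes "functionally_countable (euclidean :: 'a topology)" "continuous_on UNIV f" "s < t"
  obtains r where "s < r" "r < t" "\<And>x. f x \<noteq> r"
proof -
  have "countable (range f)"
    using assms(1,2) unfolding functionally_countable_def by simp
  then have "\<not> {s<..<t} \<subseteq> range f"
    using assms(3) countable_subset uncountable_open_interval by blast
  then obtain r where "s < r" "r < t" "r \<notin> range f"
    unfolding subset_iff greaterThanLessThan_iff by blast
  then show thesis
    using that[of r] by blast
qed

text \<open>If some pair between \<open>c\<close> and \<open>a\<close> is a jump, the ray above its
  lower point is already clopen. Otherwise the interval is densely ordered and carries a continuous
  function from 0 to 1; at an omitted value \<open>r\<close> the sets \<open>f > r\<close> and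
  \<open>f \<ge> r\<close> coincide.\<close>

lemma clopen_cut:
  fixes c a :: "'a::linorder_topology"
  assumes fc: "functionally_countable (euclidean :: 'a topology)" and ca: "c < a"
  obtains V where "open V" "closed V" "{a..} \<subseteq> V" "V \<subseteq> {c<..}"
proof (cases "\<exists>x y. c \<le> x \<and> x < y \<and> y \<le> a \<and> \<not> (\<exists>z. x < z \<and> z < y)")
  case True
  then obtain x y where xy: "c \<le> x" "x < y" "y \<le> a" "\<And>z. \<not> (x < z \<and> z < y)"
    by blast
  have "{x<..} = {y..}"
    using xy(2,4) by (force simp: not_less)
  then have "closed {x<..}"
    by simp
  with open_greaterThan show thesis
    by (rule that) (use xy in auto)
next
  case False
  then obtain f :: "'a \<Rightarrow> real" where f: "continuous_on UNIV f"
    "\<And>x. x \<le> c \<Longrightarrow> f x = 0" "\<And>x. a \<le> x \<Longrightarrow> f x = 1"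
    using continuous_map_across_dense_interval[OF ca] by metis
  obtain r where r: "0 < r" "r < 1" "\<And>x. f x \<noteq> r"
    using functionally_countable_omits[OF fc f(1), of 0 1] by auto
  have "open {x. r < f x}"
    by (intro open_Collect_less f continuous_intros)
  moreover have "{x. r < f x} = {x. r \<le> f x}"
    using r(3) by (force simp: less_le)
  moreover have "closed {x. r \<le> f x}"
    by (intro closed_Collect_le f continuous_intros)
  ultimately show thesis
    using r f by (intro that[of "{x. r < f x}"]) (force simp: not_le[symmetric])+
qed

text \<open>A greatest element \<open>c\<close> of \<open>T\<close> lies below \<open>b\<close>, and
  \<open>clopen_cut\<close> applies to this pair. Without a greatest element the closed set
  \<open>T\<close> is a union of open rays, so its complement is clopen.\<close>

lemma clopen_separating_down_set:
  fixes b :: "'a::linorder_topology"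
  assumes fc: "functionally_countable (euclidean :: 'a topology)"
    and T: "\<And>x y. \<lbrakk>x \<le> y; y \<in> T\<rbrakk> \<Longrightarrow> x \<in> T" "closed T" "b \<notin> T"
  obtains V where "open V" "closed V" "{b..} \<subseteq> V" "V \<inter> T = {}"
proof (cases "\<exists>c\<in>T. \<forall>x\<in>T. x \<le> c")
  case True
  then obtain c where c: "c \<in> T" "\<And>x. x \<in> T \<Longrightarrow> x \<le> c"
    by blast
  have "c < b"
    using T c by (meson not_le)
  then obtain V where "open V" "closed V" "{b..} \<subseteq> V" "V \<subseteq> {c<..}"
    using clopen_cut[OF fc] by blast
  with c show thesis
    by (intro that[of V]) force+
next
  case False
  have *: "T = (\<Union>c\<in>T. {..<c})"
  proof (intro equalityI subsetI)
    show "x \<in> (\<Union>c\<in>T. {..<c})" if "x \<in> T" for x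
      using False that not_le by blast
    show "x \<in> T" if "x \<in> (\<Union>c\<in>T. {..<c})" for x
      using T(1) that less_imp_le by blast
  qed
  have "open T"
    by (subst *) auto
  then show thesis
    by (intro that[of "- T"]) (use T in auto)
qed

text \<open>The order dual; here the clopen set is the complement of the one given by
  \<open>clopen_cut\<close>.\<close>

lemma clopen_separating_up_set:
  fixes b :: "'a::linorder_topology"
  assumes fc: "functionally_countable (euclidean :: 'a topology)"
    and T: "\<And>x y. \<lbrakk>y \<le> x; y \<in> T\<rbrakk> \<Longrightarrow> x \<in> T" "closed T" "b \<notin> T"
  obtains V where "open V" "closed V" "{..b} \<subseteq> V" "V \<inter> T = {}"
proof (cases "\<exists>c\<in>T. \<forall>x\<in>T. c \<le> x")
  case True
  then obtain c where c: "c \<in> T" "\<And>x. x \<in> T \<Longrightarrow> c \<le> x"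
    by blast
  have "b < c"
    using T c by (meson not_le)
  then obtain V where "open V" "closed V" "{c..} \<subseteq> V" "V \<subseteq> {b<..}"
    using clopen_cut[OF fc] by blast
  with c show thesis
    by (intro that[of "- V"]) force+
next
  case False
  have *: "T = (\<Union>c\<in>T. {c<..})"
  proof (intro equalityI subsetI)
    show "x \<in> (\<Union>c\<in>T. {c<..})" if "x \<in> T" for x
      using False that not_le by blast
    show "x \<in> T" if "x \<in> (\<Union>c\<in>T. {c<..})" for x
      using T(1) that less_imp_le by blast
  qed
  have "open T"
    by (subst *) auto
  then show thesis
    by (intro that[of "- T"]) (use T in auto)
qed

section \<open>Order-convex open sets\<close>

definition order_convex :: "'a::order set \<Rightarrow> bool" where
  "order_convex J \<longleftrightarrow> (\<forall>x\<in>J. \<forall>z\<in>J. {x..z} \<subseteq> J)"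

lemma order_convexD: "\<lbrakk>order_convex J; x \<in> J; z \<in> J; x \<le> y; y \<le> z\<rbrakk> \<Longrightarrow> y \<in> J"
  unfolding order_convex_def by (meson atLeastAtMost_iff subsetD)

text \<open>By convexity, the points outside \<open>J\<close> below \<open>b\<close> form a closed
  down-set and those above \<open>b'\<close> a closed up-set. The two clopen sets avoiding them meet
  inside \<open>J\<close>, as a common point outside \<open>J\<close> would lie strictly between
  \<open>b\<close> and \<open>b'\<close>.\<close>

lemma clopen_between_interval_and_convex:
  fixes J :: "'a::linorder_topology set"
  assumes fc: "functionally_countable (euclidean :: 'a topology)"
    and J: "open J" "order_convex J"
    and b: "b \<in> J" "b' \<in> J"
  obtains V where "open V" "closed V" "{b..b'} \<subseteq> V" "V \<subseteq> J"
proof -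
  have closed: "closed ({..b} - J)" "closed ({b'..} - J)"
    by (intro closed_Diff J closed_atMost closed_atLeast)+
  have down: "x \<in> {..b} - J" if "x \<le> y" "y \<in> {..b} - J" for x y
    using that order_convexD[OF J(2), of x b y] b by auto
  have up: "x \<in> {b'..} - J" if "y \<le> x" "y \<in> {b'..} - J" for x y
    using that order_convexD[OF J(2), of b' x y] b by auto
  have notin: "b \<notin> {..b} - J" "b' \<notin> {b'..} - J"
    using b by auto
  obtain V where V: "open V" "closed V" "{b..} \<subseteq> V" "V \<inter> ({..b} - J) = {}"
    using clopen_separating_down_set[OF fc down closed(1) notin(1)] .
  obtain W where W: "open W" "closed W" "{..b'} \<subseteq> W" "W \<inter> ({b'..} - J) = {}"
    using clopen_separating_up_set[OF fc up closed(2) notin(2)] .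
  show thesis
  proof (rule that)
    show "V \<inter> W \<subseteq> J"
    proof
      fix x assume "x \<in> V \<inter> W"
      then have "x \<in> J \<or> b < x" "x \<in> J \<or> x < b'"
        using V(4) W(4) by (auto simp: not_less[symmetric])
      then show "x \<in> J"
        using order_convexD[OF J(2), of b b' x] b by auto
    qed
  qed (use V W in auto)
qed

section \<open>Consequences of the countable chain condition\<close>

text \<open>Zorn's lemma. Maximality is used in this form: a set of \<open>\<C>\<close> disjoint
  from all of \<open>\<U>\<close> is in \<open>\<U>\<close>, hence disjoint from itself, hence
  empty.\<close>

lemma maximal_disjoint_subfamily:
  obtains \<U> where "\<U> \<subseteq> \<C>" "pairwise disjnt \<U>"
    "\<And>C. \<lbrakk>C \<in> \<C>; \<And>U. U \<in> \<U> \<Longrightarrow> disjnt C U\<rbrakk> \<Longrightarrow> C \<in> \<U>"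
proof -
  define A where "A = {\<U>. \<U> \<subseteq> \<C> \<and> pairwise disjnt \<U>}"
  have "\<exists>M\<in>A. \<forall>X\<in>A. M \<subseteq> X \<longrightarrow> X = M"
  proof (rule subset_Zorn')
    fix K assume K: "subset.chain A K"
    then have "pairwise disjnt (\<Union>K)"
      by (intro pairwise_chain_Union) (auto simp: A_def subset_chain_def chain_subset_def)
    then show "\<Union>K \<in> A"
      using K by (auto simp: A_def subset_chain_def)
  qed
  then obtain M where M: "M \<in> A" "\<And>X. \<lbrakk>X \<in> A; M \<subseteq> X\<rbrakk> \<Longrightarrow> X = M"
    by blast
  show thesis
  proof
    show "C \<in> M" if "C \<in> \<C>" "\<And>U. U \<in> M \<Longrightarrow> disjnt C U" for C
    proof -
      have "insert C M \<in> A"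
        using that M(1) by (auto simp: A_def pairwise_insert disjnt_sym)
      then show ?thesis
        using M(2)[of "insert C M"] by blast
    qed
  qed (use M in \<open>auto simp: A_def\<close>)
qed

lemma ccc_spaceD:
  assumes "ccc_space X" "\<And>U. U \<in> \<U> \<Longrightarrow> openin X U" "\<And>U. U \<in> \<U> \<Longrightarrow> U \<noteq> {}" "pairwise disjnt \<U>"
  shows "countable \<U>"
  using assms unfolding ccc_space_def by blast

text \<open>A maximal disjoint family of nonempty open intervals with end points in \<open>J\<close>
  is countable by the ccc. Its end points, together with the extreme elements of \<open>J\<close>,
  are cofinal and coinitial: otherwise a further interval would fit beyond all of them.\<close>

lemma ccc_imp_countable_cofinal_coinitial:
  fixes J :: "'a::linorder_topology set"
  assumes ccc: "ccc_space (euclidean :: 'a topology)"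
  obtains B where "countable B" "B \<subseteq> J"
    "\<And>x. x \<in> J \<Longrightarrow> \<exists>b\<in>B. x \<le> b" "\<And>x. x \<in> J \<Longrightarrow> \<exists>b\<in>B. b \<le> x"
proof -
  define I where "I = (\<lambda>(u, v). {u<..<v :: 'a})"
  define \<C> where "\<C> = I ` (J \<times> J) - {{}}"
  obtain \<U> where \<U>: "\<U> \<subseteq> \<C>" "pairwise disjnt \<U>"
    and max: "\<And>C. \<lbrakk>C \<in> \<C>; \<And>U. U \<in> \<U> \<Longrightarrow> disjnt C U\<rbrakk> \<Longrightarrow> C \<in> \<U>"
    using maximal_disjoint_subfamily by blast
  have "countable \<U>"
  proof (rule ccc_spaceD[OF ccc _ _ \<U>(2)])
    show "openin euclidean U" "U \<noteq> {}" if "U \<in> \<U>" for U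
      using that \<U>(1) by (auto simp: \<C>_def I_def)
  qed
  have "\<exists>p. p \<in> J \<times> J \<and> I p = U" if "U \<in> \<U>" for U
    using \<U>(1) that unfolding \<C>_def by blast
  then obtain e where e: "e U \<in> J \<times> J" "I (e U) = U" if "U \<in> \<U>" for U
    by metis
  \<comment> \<open>The greatest and the least element of \<open>J\<close>, as far as they exist;
    these may fail to be dominated by interval end points.\<close>
  define M where "M = {x \<in> J. (\<forall>y\<in>J. y \<le> x) \<or> (\<forall>y\<in>J. x \<le> y)}"
  have "finite {x \<in> J. \<forall>y\<in>J. y \<le> x}"
  proof (cases "\<exists>m\<in>J. \<forall>y\<in>J. y \<le> m")
    case True
    then obtain m where "m \<in> J" "\<And>y. y \<in> J \<Longrightarrow> y \<le> m" by blast
    then have "{x \<in> J. \<forall>y\<in>J. y \<le> x} \<subseteq> {m}"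
      by (auto intro: antisym)
    then show ?thesis
      by (rule finite_subset) simp
  next
    case False
    then have "{x \<in> J. \<forall>y\<in>J. y \<le> x} = {}"
      by blast
    then show ?thesis
      by (simp only: finite.emptyI)
  qed
  moreover have "finite {x \<in> J. \<forall>y\<in>J. x \<le> y}"
  proof (cases "\<exists>m\<in>J. \<forall>y\<in>J. m \<le> y")
    case True
    then obtain m where "m \<in> J" "\<And>y. y \<in> J \<Longrightarrow> m \<le> y" by blast
    then have "{x \<in> J. \<forall>y\<in>J. x \<le> y} \<subseteq> {m}"
      by (auto intro: antisym)
    then show ?thesis
      by (rule finite_subset) simp
  next
    case False
    then have "{x \<in> J. \<forall>y\<in>J. x \<le> y} = {}"
      by blast
    then show ?thesis
      by (simp only: finite.emptyI)
  qed
  moreover have "M = {x \<in> J. \<forall>y\<in>J. y \<le> x} \<union> {x \<in> J. \<forall>y\<in>J. x \<le> y}"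
    by (auto simp: M_def)
  ultimately have "finite M"
    by simp
  define B where "B = M \<union> fst ` e ` \<U> \<union> snd ` e ` \<U>"
  \<comment> \<open>If \<open>B\<close> lies entirely on one side of the interval from
    \<open>x\<close> to \<open>z\<close>, that interval is disjoint from every member of
    \<open>\<U>\<close>; the point \<open>y\<close> makes it nonempty, against maximality.\<close>
  have hit: False
    if xyz: "x \<in> J" "x < y" "y < z" "z \<in> J"
      and far: "(\<forall>b\<in>B. b \<le> x) \<or> (\<forall>b\<in>B. z \<le> b)" for x y z
  proof -
    have disj: "disjnt (I (x, z)) U" if "U \<in> \<U>" for U
    proof -
      obtain u v where uv: "e U = (u, v)"
        by fastforce
      then have "u \<in> B" "v \<in> B"
        using that by (force simp: B_def)+
      then have "v \<le> x \<or> z \<le> u"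
        using far by blast
      then have "disjnt (I (x, z)) (I (u, v))"
        by (auto simp: disjnt_iff I_def)
      then show ?thesis
        using e(2)[OF that] uv by simp
    qed
    have "I (x, z) \<in> \<C>"
      using xyz by (force simp: \<C>_def I_def)
    with max disj have "I (x, z) \<in> \<U>"
      by blast
    then have "disjnt (I (x, z)) (I (x, z))"
      using disj by blast
    then show False
      using xyz by (force simp: disjnt_iff I_def)
  qed
  show thesis
  proof
    show "countable B"
      using \<open>countable \<U>\<close> \<open>finite M\<close> by (auto simp: B_def countable_finite)
    show "B \<subseteq> J"
      using e(1) by (force simp: B_def M_def mem_Times_iff)
    show "\<exists>b\<in>B. x \<le> b" if "x \<in> J" for x
    proof (rule ccontr)
      assume "\<not> (\<exists>b\<in>B. x \<le> b)"
      then have x: "\<forall>b\<in>B. b < x" by auto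
      \<comment> \<open>A point of \<open>J\<close> beyond all of \<open>B\<close> is not in
        \<open>M\<close>, so it is not the greatest element of \<open>J\<close>. Two applications
        produce the triple for \<open>hit\<close>.\<close>
      have up: "\<exists>z\<in>J. y < z" if "y \<in> J" "x \<le> y" for y
      proof -
        have "y \<notin> B"
          using x that by force
        then show ?thesis
          using that by (auto simp: B_def M_def not_le)
      qed
      obtain y where y: "y \<in> J" "x < y"
        using up[of x] \<open>x \<in> J\<close> by auto
      obtain z where "z \<in> J" "y < z"
        using up[of y] y by (meson less_imp_le)
      then show False
        using hit[of x y z] x y \<open>x \<in> J\<close> by (meson less_imp_le less_trans)
    qed
    show "\<exists>b\<in>B. b \<le> x" if "x \<in> J" for x
    proof (rule ccontr)
      assume "\<not> (\<exists>b\<in>B. b \<le> x)"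
      then have x: "\<forall>b\<in>B. x < b" by auto
      have down: "\<exists>z\<in>J. z < y" if "y \<in> J" "y \<le> x" for y
      proof -
        have "y \<notin> B"
          using x that by force
        then show ?thesis
          using that by (auto simp: B_def M_def not_le)
      qed
      obtain y where y: "y \<in> J" "y < x"
        using down[of x] \<open>x \<in> J\<close> by auto
      obtain z where "z \<in> J" "z < y"
        using down[of y] y by (meson less_imp_le)
      then show False
        using hit[of z y x] x y \<open>x \<in> J\<close> by (meson less_imp_le less_trans)
    qed
  qed
qed

section \<open>Open sets as countable unions of clopen sets\<close>

text \<open>The intervals \<open>{b..b'}\<close> with end points in a countable cofinal and
  coinitial set \<open>B\<close> cover \<open>J\<close>, and each can be enlarged to a clopen set
  inside \<open>J\<close>.\<close>

lemma open_convex_eq_countable_Union_clopen: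
  fixes J :: "'a::linorder_topology set"
  assumes fc: "functionally_countable (euclidean :: 'a topology)"
    and ccc: "ccc_space (euclidean :: 'a topology)"
    and J: "open J" "order_convex J"
  shows "\<exists>\<V>. countable \<V> \<and> (\<forall>V\<in>\<V>. open V \<and> closed V) \<and> \<Union>\<V> = J"
proof -
  obtain B where B: "countable B" "B \<subseteq> J"
    "\<And>x. x \<in> J \<Longrightarrow> \<exists>b\<in>B. x \<le> b" "\<And>x. x \<in> J \<Longrightarrow> \<exists>b\<in>B. b \<le> x"
    using ccc_imp_countable_cofinal_coinitial[OF ccc] by metis
  have "\<exists>V. open V \<and> closed V \<and> {fst p..snd p} \<subseteq> V \<and> V \<subseteq> J" if "p \<in> B \<times> B" for p
  proof -
    have "fst p \<in> J" "snd p \<in> J"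
      using that B(2) by auto
    from clopen_between_interval_and_convex[OF fc J this] show ?thesis
      by metis
  qed
  then obtain V where V: "\<And>p. p \<in> B \<times> B \<Longrightarrow>
      open (V p) \<and> closed (V p) \<and> {fst p..snd p} \<subseteq> V p \<and> V p \<subseteq> J"
    by metis
  have "J \<subseteq> \<Union>(V ` (B \<times> B))"
  proof
    fix x assume "x \<in> J"
    then obtain b b' where "b \<in> B" "b' \<in> B" "b \<le> x" "x \<le> b'"
      using B by metis
    then show "x \<in> \<Union>(V ` (B \<times> B))"
      using V[of "(b, b')"] by force
  qed
  then show ?thesis
    using V B(1) by (intro exI[of _ "V ` (B \<times> B)"]) (fastforce intro: countable_SIGMA)
qed

text \<open>Induction over the generation of the order topology by open rays: rays are convex,
  intersections preserve convexity, and in a union one member containing \<open>x\<close>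
  suffices.\<close>

lemma open_convex_neighbourhood:
  fixes U :: "'a::linorder_topology set"
  assumes "open U" "x \<in> U"
  obtains I where "open I" "x \<in> I" "I \<subseteq> U" "order_convex I"
proof -
  have conv_Int: "order_convex (I \<inter> K)" if "order_convex I" "order_convex K" for I K
    using that unfolding order_convex_def by blast
  have "generate_topology (range lessThan \<union> range greaterThan) U"
    using assms(1) unfolding open_generated_order .
  then have "\<exists>I. open I \<and> x \<in> I \<and> I \<subseteq> U \<and> order_convex I"
    using assms(2)
  proof (induction rule: generate_topology.induct)
    case UNIV
    show ?case
      by (intro exI[of _ UNIV]) (simp add: order_convex_def)
  next
    case (Int S T)
    then obtain I K where "open I" "x \<in> I" "I \<subseteq> S" "order_convex I"
      "open K" "x \<in> K" "K \<subseteq> T" "order_convex K"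
      by blast
    then show ?case
      by (intro exI[of _ "I \<inter> K"]) (auto intro: conv_Int)
  next
    case (UN K)
    then show ?case
      by (meson UnionE Union_upper order_trans)
  next
    case (Basis S)
    then show ?case
      by (intro exI[of _ S]) (auto simp: order_convex_def)
  qed
  then show thesis
    using that by blast
qed

text \<open>The convex components of \<open>U\<close> are open, nonempty and pairwise disjoint,
  hence countable in number by the ccc, and each of them is a countable union of clopen
  sets.\<close>

lemma open_eq_countable_Union_clopen:
  fixes U :: "'a::linorder_topology set"
  assumes fc: "functionally_countable (euclidean :: 'a topology)"
    and ccc: "ccc_space (euclidean :: 'a topology)" and U: "open U"
  shows "\<exists>\<V>. countable \<V> \<and> (\<forall>V\<in>\<V>. open V \<and> closed V) \<and> \<Union>\<V> = U"
proof -
  text \<open>The convex component of \<open>a\<close> in \<open>U\<close>.\<close>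
  define J where "J a = {x. {min a x..max a x} \<subseteq> U}" for a
  have J_sub: "J a \<subseteq> U" for a
    by (force simp: J_def)
  have J_self: "a \<in> J a" if "a \<in> U" for a
    using that by (simp add: J_def)
  have J_sym: "x \<in> J a \<longleftrightarrow> a \<in> J x" for a x
    by (simp add: J_def min.commute max.commute)
  have J_trans: "z \<in> J x" if "y \<in> J x" "z \<in> J y" for x y z
  proof -
    \<comment> \<open>Wherever \<open>y\<close> lies, the intervals joining it to \<open>x\<close>
      and to \<open>z\<close> together cover the interval joining \<open>x\<close> and
      \<open>z\<close>.\<close>
    have "{min x z..max x z} \<subseteq> {min x y..max x y} \<union> {min y z..max y z}"
      by (auto simp: min_def max_def split: if_splits)
    then show ?thesis
      using that by (auto simp: J_def)
  qed
  have J_eq: "J x = J y" if "x \<in> J y" for x y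
    using that J_trans J_sym by blast
  have J_convex: "order_convex (J a)" for a
    unfolding order_convex_def
  proof (intro ballI subsetI)
    fix x y z assume that: "x \<in> J a" "z \<in> J a" "y \<in> {x..z}"
    have "{min a y..max a y} \<subseteq> {min a x..max a x} \<union> {min a z..max a z}"
      using that(3) by (auto simp: min_def max_def split: if_splits)
    then show "y \<in> J a"
      using that by (auto simp: J_def)
  qed
  have J_nhd: "I \<subseteq> J x" if "x \<in> I" "I \<subseteq> U" "order_convex I" for x I
  proof
    fix y assume "y \<in> I"
    then have "{min x y..max x y} \<subseteq> I"
      using that(1,3) by (auto simp: order_convex_def min_def max_def)
    then show "y \<in> J x"
      using that(2) by (auto simp: J_def)
  qed
  have J_open: "open (J a)" for a
  proof (subst open_subopen, intro ballI)
    fix x assume x: "x \<in> J a"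
    then obtain I where I: "open I" "x \<in> I" "I \<subseteq> U" "order_convex I"
      using open_convex_neighbourhood[OF U, of x] J_sub by blast
    then have "I \<subseteq> J a"
      using J_nhd J_eq x by metis
    with I show "\<exists>T. open T \<and> x \<in> T \<and> T \<subseteq> J a"
      by blast
  qed
  have "countable (J ` U)"
  proof -
    have "pairwise disjnt (J ` U)"
      unfolding pairwise_def disjnt_iff using J_eq by (metis (no_types, lifting) imageE)
    moreover have "openin euclidean K" "K \<noteq> {}" if "K \<in> J ` U" for K
      using that J_open J_self by auto
    ultimately show ?thesis
      by (intro ccc_spaceD[OF ccc])
  qed
  moreover have "\<exists>\<V>. countable \<V> \<and> (\<forall>V\<in>\<V>. open V \<and> closed V) \<and> \<Union>\<V> = K" if "K \<in> J ` U" for K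
    using that open_convex_eq_countable_Union_clopen[OF fc ccc J_open J_convex] by blast
  then obtain \<V> where \<V>: "\<And>K. K \<in> J ` U \<Longrightarrow>
      countable (\<V> K) \<and> (\<forall>V\<in>\<V> K. open V \<and> closed V) \<and> \<Union>(\<V> K) = K"
    by metis
  moreover have "\<Union>(\<Union>(\<V> ` J ` U)) = U"
  proof -
    have "\<Union>(\<Union>(\<V> ` J ` U)) = (\<Union>K\<in>J ` U. \<Union>(\<V> K))"
      by blast
    also have "\<dots> = (\<Union>K\<in>J ` U. K)"
      using \<V> by (intro SUP_cong) auto
    also have "\<dots> = U"
      using J_sub J_self by auto
    finally show ?thesis .
  qed
  ultimately have "countable (\<Union>(\<V> ` J ` U)) \<and>
      (\<forall>V\<in>\<Union>(\<V> ` J ` U). open V \<and> closed V) \<and> \<Union>(\<Union>(\<V> ` J ` U)) = U"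
    by (intro conjI countable_UN) auto
  then show ?thesis ..
qed

section \<open>Functional countability implies exponential separability\<close>

lemma continuous_on_indicator_clopen:
  assumes "open V" "closed V"
  shows "continuous_on UNIV (indicator V :: 'a::topological_space \<Rightarrow> real)"
  unfolding indicator_def
  using continuous_on_If[of V "- V" "\<lambda>_. 1::real" "\<lambda>_. 0" "\<lambda>x. x \<in> V"] assms
  by (simp add: closed_Compl of_bool_def)

text \<open>The Cantor-set coding: \<open>f\<close> is the uniformly convergent sum of the
  indicators weighted by \<open>(1/3)^n\<close>. Base 3 makes all terms after index \<open>n\<close>
  sum to at most half of \<open>(1/3)^n\<close>, so the first \<open>n\<close> at which two points
  differ decides which value is larger.\<close>

lemma continuous_map_separating_clopens:
  fixes V :: "nat \<Rightarrow> 'a::topological_space set"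
  assumes V: "\<And>n. open (V n)" "\<And>n. closed (V n)"
  obtains f :: "'a \<Rightarrow> real"
  where "continuous_on UNIV f" "\<And>x y n. f x = f y \<Longrightarrow> x \<in> V n \<longleftrightarrow> y \<in> V n"
proof -
  define g where "g n x = indicator (V n) x * (1/3::real)^n" for n x
  define f where "f x = (\<Sum>n. g n x)" for x
  have g: "0 \<le> g n x" "g n x \<le> (1/3)^n" for n x
    by (auto simp: g_def indicator_def)
  have geom: "summable (\<lambda>n. (1/3::real)^n)"
    by (simp add: summable_geometric)
  have sumg: "summable (\<lambda>n. g n x)" for x
    by (rule summable_comparison_test[OF _ geom]) (use g in auto)
  have "uniform_limit UNIV (\<lambda>n x. \<Sum>i<n. g i x) f sequentially"
    unfolding f_def by (rule Weierstrass_m_test[OF _ geom]) (use g in auto)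
  moreover have "continuous_on UNIV (\<lambda>x. \<Sum>i<n. g i x)" for n
    unfolding g_def by (intro continuous_intros continuous_on_indicator_clopen V)
  ultimately have "continuous_on UNIV f"
    by (intro uniform_limit_theorem[of UNIV "\<lambda>n x. \<Sum>i<n. g i x"]) auto
  moreover have less: "f y < f x"
    if n: "x \<in> V n" "y \<notin> V n" "\<And>k. k < n \<Longrightarrow> x \<in> V k \<longleftrightarrow> y \<in> V k" for x y n
  proof -
    have split: "f z = (\<Sum>k. g (k + Suc n) z) + (\<Sum>k<n. g k z) + g n z" for z
      unfolding f_def by (subst suminf_split_initial_segment[OF sumg, of _ "Suc n"]) simp
    have "(\<Sum>k. g (k + Suc n) y) \<le> (\<Sum>k. (1/3)^(k + Suc n))"
      by (intro suminf_le g summable_ignore_initial_segment geom sumg)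
    also have "\<dots> = (1/3)^Suc n * (\<Sum>k. (1/3::real)^k)"
      by (subst suminf_mult[symmetric]) (auto simp: power_add summable_geometric mult.commute)
    also have "\<dots> < (1/3)^n"
      by (simp add: suminf_geometric)
    finally have "(\<Sum>k. g (k + Suc n) y) < (1/3)^n" .
    moreover have "0 \<le> (\<Sum>k. g (k + Suc n) x)"
      by (intro suminf_nonneg g summable_ignore_initial_segment sumg)
    moreover have "(\<Sum>k<n. g k x) = (\<Sum>k<n. g k y)"
      using n(3) by (intro sum.cong) (auto simp: g_def indicator_def)
    moreover have "g n x = (1/3)^n" "g n y = 0"
      using n by (auto simp: g_def)
    ultimately show ?thesis
      unfolding split by simp
  qed
  have "x \<in> V n \<longleftrightarrow> y \<in> V n" if "f x = f y" for x y n
  proof (rule ccontr)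
    assume "(x \<in> V n) \<noteq> (y \<in> V n)"
    then obtain m where "(x \<in> V m) \<noteq> (y \<in> V m)" "\<And>k. k < m \<Longrightarrow> x \<in> V k \<longleftrightarrow> y \<in> V k"
      using exists_least_iff[of "\<lambda>n. (x \<in> V n) \<noteq> (y \<in> V n)"] by blast
    then show False
      using less[of x m y] less[of y m x] that by auto
  qed
  ultimately show thesis
    using that by blast
qed

lemma functionally_countable_imp_exponentially_separable:
  assumes fc: "functionally_countable (euclidean :: 'a::topological_space topology)"
    and clopen: "\<And>U :: 'a set. open U \<Longrightarrow>
      \<exists>\<V>. countable \<V> \<and> (\<forall>V\<in>\<V>. open V \<and> closed V) \<and> \<Union>\<V> = U"
  shows "exponentially_separable (euclidean :: 'a topology)"
  unfolding exponentially_separable_def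
proof (intro allI impI, elim conjE)
  fix \<F> :: "'a set set"
  assume \<F>: "countable \<F>" "\<forall>C\<in>\<F>. closedin euclidean C"
  then have "\<exists>\<V>. countable \<V> \<and> (\<forall>V\<in>\<V>. open V \<and> closed V) \<and> \<Union>\<V> = - C" if "C \<in> \<F>" for C
    using that by (intro clopen) auto
  then obtain \<V> where \<V>: "\<And>C. C \<in> \<F> \<Longrightarrow>
      countable (\<V> C) \<and> (\<forall>V\<in>\<V> C. open V \<and> closed V) \<and> \<Union>(\<V> C) = - C"
    by metis
  \<comment> \<open>Adding \<open>UNIV\<close> makes the family nonempty even when
    \<open>\<F>\<close> is empty, so that \<open>from_nat_into\<close> enumerates exactly
    \<open>\<W>\<close>.\<close>
  define \<W> where "\<W> = insert UNIV (\<Union>(\<V> ` \<F>))"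
  have \<W>: "countable \<W>" "\<W> \<noteq> {}" "\<And>V. V \<in> \<W> \<Longrightarrow> open V \<and> closed V"
    using \<V> \<F>(1) by (auto simp: \<W>_def)
  have range: "range (from_nat_into \<W>) = \<W>"
    using \<W> by (intro range_from_nat_into)
  obtain f :: "'a \<Rightarrow> real" where f: "continuous_on UNIV f"
    "\<And>x y n. f x = f y \<Longrightarrow> x \<in> from_nat_into \<W> n \<longleftrightarrow> y \<in> from_nat_into \<W> n"
    using continuous_map_separating_clopens[of "from_nat_into \<W>"] \<W> range by (metis rangeI)
  have f': "x \<in> V \<longleftrightarrow> y \<in> V" if "f x = f y" "V \<in> \<W>" for x y V
    using f(2)[OF that(1)] that(2) range by (metis imageE)
  \<comment> \<open>The complement of \<open>C\<close> is a union of members of \<open>\<W>\<close>,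
    none of which separates points of one fibre; hence \<open>C\<close> is a union of fibres of
    \<open>f\<close>.\<close>
  have same: "y \<in> C" if "f x = f y" "x \<in> C" "C \<in> \<F>" for x y C
    using \<V>[OF that(3)] f'[OF that(1)] that(2,3) unfolding \<W>_def
    by (metis ComplD ComplI UN_I UnionE UnionI insertI2)
  \<comment> \<open>One point from each fibre, with countably many fibres by functional
    countability.\<close>
  define A where "A = inv f ` range f"
  have "countable A"
    using fc f(1) unfolding A_def functionally_countable_def by simp
  moreover have "strongly_dense_in euclidean A \<F>"
    unfolding strongly_dense_in_def
  proof (intro allI impI, elim conjE)
    fix \<G> assume "\<G> \<subseteq> \<F>" "topspace euclidean \<inter> \<Inter>\<G> \<noteq> {}"
    then obtain x where x: "x \<in> \<Inter>\<G>"
      by auto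
    have "f x = f (inv f (f x))"
      by (simp add: f_inv_into_f)
    then have "inv f (f x) \<in> \<Inter>\<G>"
      using x same \<open>\<G> \<subseteq> \<F>\<close> by blast
    moreover have "inv f (f x) \<in> A"
      by (simp add: A_def)
    ultimately show "A \<inter> (topspace euclidean \<inter> \<Inter>\<G>) \<noteq> {}"
      by auto
  qed
  ultimately show "\<exists>A. countable A \<and> A \<subseteq> topspace euclidean \<and> strongly_dense_in euclidean A \<F>"
    by auto
qed

theorem proposition7:
  assumes "souslin_line TYPE('a::linorder_topology)"
  shows "functionally_countable (euclidean :: 'a topology) \<longleftrightarrow>
         exponentially_separable (euclidean :: 'a topology)"
proof
  have "ccc_space (euclidean :: 'a topology)"
    using assms by (simp add: souslin_line_def)
  then show "exponentially_separable (euclidean :: 'a topology)"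
    if "functionally_countable (euclidean :: 'a topology)"
    using that functionally_countable_imp_exponentially_separable[OF that]
      open_eq_countable_Union_clopen[OF that] by blast
qed (rule exponentially_separable_imp_functionally_countable)

end
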